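(* Let $A \in \mathbb{R}^{m\times n}$ and $B \in \mathbb{R}^{l\times n}$, assume $B$ is injective (i.e., $B$ is full rank with $n \leq l$), and let $\|\cdot\|_{\mathcal{V}}$ be a norm on $\mathbb{R}^{m}$ and $\|\cdot\|_{\mathcal{W}}$ a norm on $\mathbb{R}^l$. Furthermore, let $c \in \mathbb{R}^n$. Then $$\max_{x\in\mathbb{R}^n,\ \|Bx\|_{\mathcal{W}}\leq 1}\left(\|Ax\|_{\mathcal{V}}+c^\top x\right) = \max_{\alpha\in\mathbb{R}^m,\ \|\alpha\|_{\mathcal{V}}^*\leq 1} \ \min_{\beta\in\mathbb{R}^l,\ B^\top\beta = A^\top\alpha + c} \ \|\beta\|_{\mathcal{W}}^*.$$ In particular, for $c = 0$, $$\max_{x\in\mathbb{R}^n,\ \|Bx\|_{\mathcal{W}}\leq 1}\|Ax\|_{\mathcal{V}} = \max_{\alpha\in\mathbb{R}^m,\ \|\alpha\|_{\mathcal{V}}^*\leq 1} \ \min_{\beta\in\mathbb{R}^l,\ B^\top\beta = A^\top\alpha} \ \|\beta\|_{\mathcal{W}}^*.$$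
   Context: For a norm $\|\cdot\|$ on $\mathbb{R}^k$, the dual norm on $\mathbb{R}^k$ is $\|y\|^* = \sup_{\|x\|\le 1} x^\top y$. *)

theory Defs
  imports "HOL-Analysis.Analysis"
begin

definition is_norm :: "(real ^ 'k \<Rightarrow> real) \<Rightarrow> bool" where
  "is_norm N \<longleftrightarrow>
     (\<forall>x. 0 \<le> N x) \<and>
     (\<forall>x. N x = 0 \<longleftrightarrow> x = 0) \<and>
     (\<forall>a x. N (a *\<^sub>R x) = \<bar>a\<bar> * N x) \<and>
     (\<forall>x y. N (x + y) \<le> N x + N y)"

(* For a norm N the unit ball is bounded, so the real-valued SUP is the true supremum. *)
definition dual_norm :: "(real ^ 'k \<Rightarrow> real) \<Rightarrow> real ^ 'k \<Rightarrow> real" where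
  "dual_norm N y = (SUP x \<in> {x. N x \<le> 1}. x \<bullet> y)"

(* has_max f S M: the function f attains a maximum on S, and its value is M. Unlike an equation
   between suprema of reals, this is false if the maximum does not exist. *)
definition has_max :: "('a \<Rightarrow> real) \<Rightarrow> 'a set \<Rightarrow> real \<Rightarrow> bool" where
  "has_max f S M \<longleftrightarrow> (\<exists>x\<in>S. f x = M) \<and> (\<forall>x\<in>S. f x \<le> M)"

definition has_min :: "('a \<Rightarrow> real) \<Rightarrow> 'a set \<Rightarrow> real \<Rightarrow> bool" where
  "has_min f S M \<longleftrightarrow> (\<exists>x\<in>S. f x = M) \<and> (\<forall>x\<in>S. M \<le> f x)"

end

theory Submission
  imports Defs
begin

text \<open>
  Since \<open>B\<close> is injective, \<open>x \<mapsto> normW (B x)\<close> is a norm, so its unit ball \<open>K\<close> is compact. For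
  fixed \<alpha> put \<open>d = A\<^sup>T \<alpha> + c\<close>. The inner minimum over \<beta> equals the maximum of \<open>d \<bullet> x\<close> on \<open>K\<close>:
  every \<beta> with \<open>B\<^sup>T \<beta> = d\<close> satisfies \<open>d \<bullet> x = \<beta> \<bullet> B x \<le> dual_norm normW \<beta>\<close> on \<open>K\<close>, and conversely
  the functional \<open>B x \<mapsto> d \<bullet> x\<close> on the range of \<open>B\<close>, being bounded by \<open>max\<^sub>K d\<close> times \<open>normW\<close>,
  extends to the whole space with the same bound. This is Hahn--Banach, obtained here by
  separating a convex set from the origin (\<open>dominated_extension\<close>), and it yields
  \<open>min_dual_norm_eq_max_linear\<close>.

  It remains to maximise \<open>d \<bullet> x = \<alpha> \<bullet> A x + c \<bullet> x\<close> over both \<alpha> in the dual unit ball and \<open>x\<close> in \<open>K\<close>.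
  Taking \<alpha> first gives \<open>normV (A x) + c \<bullet> x\<close>, because every vector has a norming functional
  (\<open>norming_functional\<close>, again by extension). All maxima are attained: the outer one at an \<alpha>
  that norms \<open>A x\<close> for a maximiser \<open>x\<close> of the left-hand side.
\<close>

lemma is_norm_nonneg: "is_norm N \<Longrightarrow> 0 \<le> N x"
  and is_norm_zero: "is_norm N \<Longrightarrow> N 0 = 0"
  and is_norm_pos: "is_norm N \<Longrightarrow> x \<noteq> 0 \<Longrightarrow> 0 < N x"
  and is_norm_scale: "is_norm N \<Longrightarrow> N (a *\<^sub>R x) = \<bar>a\<bar> * N x"
  and is_norm_triangle: "is_norm N \<Longrightarrow> N (x + y) \<le> N x + N y"
  unfolding is_norm_def by (auto simp: less_le)

lemma is_norm_convex_on: "is_norm N \<Longrightarrow> convex_on UNIV N"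
proof (rule convex_onI)
  fix t :: real and x y
  assume N: "is_norm N" and t: "0 < t" "t < 1"
  show "N ((1 - t) *\<^sub>R x + t *\<^sub>R y) \<le> (1 - t) * N x + t * N y"
    using is_norm_triangle[OF N, of "(1 - t) *\<^sub>R x" "t *\<^sub>R y"] t
    by (simp add: is_norm_scale[OF N])
qed simp

lemma is_norm_continuous_on: "is_norm N \<Longrightarrow> continuous_on S N"
  using convex_on_continuous[OF open_UNIV is_norm_convex_on] continuous_on_subset by blast

lemma is_norm_dominates_euclidean:
  fixes N :: "real ^ 'k \<Rightarrow> real"
  assumes N: "is_norm N"
  obtains \<delta> where "\<delta> > 0" "\<And>x. \<delta> * norm x \<le> N x"
proof -
  have "sphere 0 1 \<noteq> ({} :: (real ^ 'k) set)"
    using vector_choose_size[of 1] by auto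
  then obtain u where u: "norm u = 1" and min: "\<And>y :: real ^ 'k. norm y = 1 \<Longrightarrow> N u \<le> N y"
    using continuous_attains_inf[OF compact_sphere _ is_norm_continuous_on[OF N]]
    by (metis mem_sphere_0)
  have "N u * norm x \<le> N x" for x
  proof (cases "x = 0")
    case False
    then have "N u \<le> N ((1 / norm x) *\<^sub>R x)"
      by (intro min) simp
    then show ?thesis
      using False by (simp add: is_norm_scale[OF N] field_simps)
  qed (simp add: is_norm_zero[OF N])
  moreover have "N u > 0"
    using is_norm_pos[OF N, of u] u by (cases "u = 0") auto
  ultimately show thesis using that by blast
qed

lemma is_norm_compact_unit_ball:
  fixes N :: "real ^ 'k \<Rightarrow> real"
  assumes N: "is_norm N"
  shows "compact {x. N x \<le> 1}"
proof -
  obtain \<delta> where \<delta>: "\<delta> > 0" "\<And>x. \<delta> * norm x \<le> N x"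
    using is_norm_dominates_euclidean[OF N] by blast
  have "norm x \<le> 1 / \<delta>" if "N x \<le> 1" for x
    using \<delta>(2)[of x] that \<delta>(1) by (simp add: field_simps)
  then have "bounded {x. N x \<le> 1}"
    by (auto simp: bounded_iff)
  moreover have "closed {x. N x \<le> 1}"
    by (intro closed_Collect_le is_norm_continuous_on[OF N] continuous_intros)
  ultimately show ?thesis by (simp add: compact_eq_bounded_closed)
qed

lemma is_norm_compose_inj:
  fixes B :: "real ^ 'n ^ 'l"
  assumes "inj (\<lambda>x. B *v x)" and N: "is_norm N"
  shows "is_norm (\<lambda>x. N (B *v x))"
proof -
  have "B *v x = 0 \<longleftrightarrow> x = 0" for x
    using injD[OF assms(1), of x 0] by auto
  then show ?thesis
    using N unfolding is_norm_def
    by (auto simp: matrix_vector_right_distrib matrix_vector_mult_scaleR)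
qed

lemma attains_max_on_unit_ball:
  fixes N f :: "real ^ 'k \<Rightarrow> real"
  assumes N: "is_norm N" and f: "continuous_on UNIV f"
  obtains M where "has_max f {x. N x \<le> 1} M"
proof -
  have "0 \<in> {x. N x \<le> 1}" by (simp add: is_norm_zero[OF N])
  then have "\<exists>x\<in>{x. N x \<le> 1}. \<forall>y\<in>{x. N x \<le> 1}. f y \<le> f x"
    using continuous_attains_sup[OF is_norm_compact_unit_ball[OF N] _ continuous_on_subset[OF f]]
    by blast
  then show thesis
    using that unfolding has_max_def by blast
qed

lemma bound_on_unit_ball_homogeneous:
  assumes N: "is_norm N" and bound: "\<And>x. N x \<le> 1 \<Longrightarrow> x \<bullet> y \<le> M"
  shows "x \<bullet> y \<le> M * N x"
proof (cases "x = 0")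
  case False
  then have pos: "N x > 0" by (rule is_norm_pos[OF N])
  then have "((1 / N x) *\<^sub>R x) \<bullet> y \<le> M"
    by (intro bound) (simp add: is_norm_scale[OF N])
  then show ?thesis using pos by (simp add: field_simps)
qed (simp add: is_norm_zero[OF N])

lemma inner_le_dual_norm:
  assumes N: "is_norm N" and x: "N x \<le> 1"
  shows "x \<bullet> y \<le> dual_norm N y"
proof -
  have "continuous_on UNIV (\<lambda>x. x \<bullet> y)" by (intro continuous_intros)
  then obtain M where "has_max (\<lambda>x. x \<bullet> y) {x. N x \<le> 1} M"
    using attains_max_on_unit_ball[OF N] by blast
  then have "bdd_above ((\<lambda>x. x \<bullet> y) ` {x. N x \<le> 1})"
    unfolding has_max_def bdd_above_def by auto
  then show ?thesis
    unfolding dual_norm_def using x by (intro cSUP_upper) auto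
qed

lemma inner_le_norm_dual_norm:
  assumes "is_norm N"
  shows "x \<bullet> y \<le> dual_norm N y * N x"
  using bound_on_unit_ball_homogeneous[OF assms inner_le_dual_norm[OF assms]] .

lemma dual_norm_le:
  assumes N: "is_norm N" and bound: "\<And>x. N x \<le> 1 \<Longrightarrow> x \<bullet> y \<le> M"
  shows "dual_norm N y \<le> M"
proof -
  have "{x. N x \<le> 1} \<noteq> {}"
    using is_norm_zero[OF N] by (intro ex_in_conv[THEN iffD1] exI[of _ 0]) simp
  then show ?thesis
    unfolding dual_norm_def using bound by (intro cSUP_least) auto
qed

text \<open>
  The finite-dimensional Hahn--Banach theorem, with the subspace given as the range of a linear
  map. The set \<open>{(z + L x, s + d \<bullet> x). p z < s}\<close> is the strict epigraph of \<open>p\<close> translated along the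
  graph of the partial functional. The hypothesis at \<open>- x\<close> says exactly that it avoids the
  origin, so a hyperplane supports it there; domination makes that hyperplane non-vertical,
  and its slope is the extension.
\<close>

lemma dominated_extension:
  fixes p :: "'a::euclidean_space \<Rightarrow> real" and L :: "'b::real_inner \<Rightarrow> 'a"
  assumes L: "linear L"
    and subadd: "\<And>x y. p (x + y) \<le> p x + p y"
    and homog: "\<And>a x. 0 \<le> a \<Longrightarrow> p (a *\<^sub>R x) = a * p x"
    and dom: "\<And>x. d \<bullet> x \<le> p (L x)"
  obtains \<beta> where "\<And>x. \<beta> \<bullet> L x = d \<bullet> x" "\<And>z. \<beta> \<bullet> z \<le> p z"
proof -
  define E where "E = {(z + L x, s + d \<bullet> x) | z x s. p z < s}"
  have "convex E"
  proof (rule convexI)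
    fix P Q :: "'a \<times> real" and u v :: real
    assume "P \<in> E" "Q \<in> E" and uv: "0 \<le> u" "0 \<le> v" "u + v = 1"
    then obtain z x s z' x' s' where
      P: "P = (z + L x, s + d \<bullet> x)" "p z < s" and Q: "Q = (z' + L x', s' + d \<bullet> x')" "p z' < s'"
      unfolding E_def by blast
    have "p (u *\<^sub>R z + v *\<^sub>R z') \<le> u * p z + v * p z'"
      using subadd[of "u *\<^sub>R z" "v *\<^sub>R z'"] uv by (simp add: homog)
    also have "\<dots> < u * s + v * s'"
    proof (cases "u = 0")
      case False
      then have "u * p z < u * s" using P(2) uv by simp
      moreover have "v * p z' \<le> v * s'" using Q(2) uv by (simp add: mult_left_mono)
      ultimately show ?thesis by simp
    qed (use Q(2) uv in simp)
    finally have "p (u *\<^sub>R z + v *\<^sub>R z') < u * s + v * s'" .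
    moreover have "u *\<^sub>R P + v *\<^sub>R Q =
        ((u *\<^sub>R z + v *\<^sub>R z') + L (u *\<^sub>R x + v *\<^sub>R x'),
         (u * s + v * s') + d \<bullet> (u *\<^sub>R x + v *\<^sub>R x'))"
      unfolding P Q
      by (simp add: linear_add[OF L] linear_scale[OF L] inner_add_right algebra_simps)
    ultimately show "u *\<^sub>R P + v *\<^sub>R Q \<in> E"
      unfolding E_def by blast
  qed
  moreover have "0 \<notin> E"
  proof
    assume "0 \<in> E"
    then obtain z x s where z: "z + L x = 0" "s + d \<bullet> x = 0" "p z < s"
      unfolding E_def by (auto simp: prod_eq_iff)
    have "z = L (- x)"
      using z(1) by (simp add: linear_neg[OF L] add_eq_0_iff2)
    then show False
      using dom[of "- x"] z by simp
  qed
  ultimately obtain a where "a \<noteq> 0" and a: "\<And>P. P \<in> E \<Longrightarrow> 0 \<le> a \<bullet> P"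
    using separating_hyperplane_set_0 by blast
  obtain \<gamma> r where ar: "a = (\<gamma>, r)" by (cases a)
  have sep: "0 \<le> \<gamma> \<bullet> (z + L x) + r * (s + d \<bullet> x)" if "p z < s" for z x s
    using a[of "(z + L x, s + d \<bullet> x)"] that unfolding E_def ar by auto
  have p0: "p 0 = 0" using homog[of 0 0] by simp
  have L0: "L 0 = 0" by (rule linear_0[OF L])
  have slab: "0 \<le> \<gamma> \<bullet> z + r * s" if "p z < s" for z s
    using sep[of z s 0] that by (simp add: L0)
  have "r \<noteq> 0"
  proof
    assume "r = 0"
    then have "0 \<le> \<gamma> \<bullet> (- \<gamma>)"
      using slab[of "- \<gamma>" "p (- \<gamma>) + 1"] by simp
    then have "\<gamma> = 0"
      by (metis inner_ge_zero inner_minus_right inner_eq_zero_iff neg_0_le_iff_le order_antisym)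
    then show False using \<open>a \<noteq> 0\<close> \<open>r = 0\<close> ar by (simp add: zero_prod_def)
  qed
  moreover have "0 \<le> r" using slab[of 0 1] by (simp add: p0)
  ultimately have r: "r > 0" by simp
  define \<beta> where "\<beta> = (- 1 / r) *\<^sub>R \<gamma>"
  show thesis
  proof (rule that)
    fix z
    have "\<beta> \<bullet> z \<le> s" if "p z < s" for s
      using slab[OF that] r by (simp add: \<beta>_def field_simps)
    then show "\<beta> \<bullet> z \<le> p z" by (rule dense_ge)
  next
    fix x
    define k where "k = \<gamma> \<bullet> L x + r * (d \<bullet> x)"
    have line: "0 \<le> r + t * k" for t
      using sep[of 0 1 "t *\<^sub>R x"]
      by (simp add: p0 k_def linear_scale[OF L] algebra_simps)
    \<comment> \<open>An affine function of \<open>t\<close> that is bounded below has slope zero.\<close>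
    have "k = 0"
    proof (rule ccontr)
      assume "k \<noteq> 0"
      then show False using line[of "- (r + 1) / k"] by simp
    qed
    then show "\<beta> \<bullet> L x = d \<bullet> x"
      using r by (simp add: k_def \<beta>_def field_simps)
  qed
qed

text \<open>
  The functional \<open>t v \<mapsto> t N v\<close> on the line through \<open>v\<close> is dominated by \<open>N\<close>; extend it.
\<close>

lemma norming_functional:
  assumes N: "is_norm N"
  obtains \<alpha> where "dual_norm N \<alpha> \<le> 1" "\<alpha> \<bullet> v = N v"
proof -
  have "linear (\<lambda>t. t *\<^sub>R v)" by (simp add: linear_iff scaleR_add_left)
  moreover have "N v \<bullet> t \<le> N (t *\<^sub>R v)" for t
    using mult_right_mono[OF abs_ge_self is_norm_nonneg[OF N], of t v]
    by (simp add: is_norm_scale[OF N] mult.commute)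
  ultimately obtain \<alpha> where \<alpha>: "\<And>t. \<alpha> \<bullet> (t *\<^sub>R v) = N v \<bullet> t" "\<And>z. \<alpha> \<bullet> z \<le> N z"
    using dominated_extension[of "\<lambda>t. t *\<^sub>R v" N "N v"]
    by (metis N abs_of_nonneg is_norm_scale is_norm_triangle)
  have "dual_norm N \<alpha> \<le> 1"
    using \<alpha>(2) by (intro dual_norm_le[OF N]) (metis inner_commute order_trans)
  then show thesis using that \<alpha>(1)[of 1] by simp
qed

lemma inner_transpose_mult:
  fixes B :: "real ^ 'n ^ 'l"
  shows "(transpose B *v y) \<bullet> x = y \<bullet> (B *v x)"
  by (simp only: transpose_matrix_vector dot_lmul_matrix)

text \<open>
  The inner minimum of the theorem is a quotient norm of the dual of \<open>N\<close>, and hence is dual to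
  the restriction of \<open>N\<close> to the range of \<open>B\<close>.
\<close>

lemma min_dual_norm_eq_max_linear:
  fixes B :: "real ^ 'n ^ 'l"
  assumes inj: "inj (\<lambda>x. B *v x)" and N: "is_norm N"
  obtains M where "has_max (\<lambda>x. d \<bullet> x) {x. N (B *v x) \<le> 1} M"
    "has_min (dual_norm N) {\<beta>. transpose B *v \<beta> = d} M"
proof -
  note NB = is_norm_compose_inj[OF inj N]
  have "continuous_on UNIV (\<lambda>x. d \<bullet> x)" by (intro continuous_intros)
  then obtain M where M: "has_max (\<lambda>x. d \<bullet> x) {x. N (B *v x) \<le> 1} M"
    using attains_max_on_unit_ball[OF NB] by blast
  then have le_M: "\<And>x. N (B *v x) \<le> 1 \<Longrightarrow> d \<bullet> x \<le> M"
    unfolding has_max_def by blast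
  have M0: "0 \<le> M" using le_M[of 0] by (simp add: is_norm_zero[OF N])
  have weak: "M \<le> dual_norm N \<beta>" if "transpose B *v \<beta> = d" for \<beta>
  proof -
    obtain x where "N (B *v x) \<le> 1" "d \<bullet> x = M"
      using M unfolding has_max_def by blast
    moreover have "d \<bullet> x = (B *v x) \<bullet> \<beta>"
      unfolding that[symmetric] by (metis inner_transpose_mult inner_commute)
    ultimately show ?thesis using inner_le_dual_norm[OF N] by metis
  qed
  have sub: "M * N (x + y) \<le> M * N x + M * N y" for x y
    using mult_left_mono[OF is_norm_triangle[OF N] M0] by (simp add: distrib_left)
  have hom: "M * N (a *\<^sub>R x) = a * (M * N x)" if "0 \<le> a" for a x
    using that by (simp add: is_norm_scale[OF N])
  have dom: "d \<bullet> x \<le> M * N (B *v x)" for x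
    using bound_on_unit_ball_homogeneous[OF NB, of d M x] le_M by (simp add: inner_commute)
  obtain \<beta> where \<beta>: "\<And>x. \<beta> \<bullet> (B *v x) = d \<bullet> x" "\<And>z. \<beta> \<bullet> z \<le> M * N z"
    using dominated_extension[OF matrix_vector_mul_linear sub hom dom] by metis
  have feas: "transpose B *v \<beta> = d"
    using \<beta>(1) by (metis inner_transpose_mult vector_eq_rdot)
  have "dual_norm N \<beta> \<le> M"
  proof (rule dual_norm_le[OF N])
    fix z assume "N z \<le> 1"
    then have "M * N z \<le> M" using M0 by (simp add: mult_left_le)
    then show "z \<bullet> \<beta> \<le> M" using \<beta>(2)[of z] by (simp add: inner_commute)
  qed
  then have "has_min (dual_norm N) {\<beta>. transpose B *v \<beta> = d} M"
    unfolding has_min_def using weak feas by (auto intro: antisym)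
  then show thesis using that M by blast
qed

lemma max_norm_eq_max_min_dual_norm:
  fixes A :: "real ^ 'n ^ 'm" and B :: "real ^ 'n ^ 'l"
  assumes inj: "inj (\<lambda>x. B *v x)" and V: "is_norm normV" and W: "is_norm normW"
  shows "\<exists>M \<mu>.
           has_max (\<lambda>x. normV (A *v x) + c \<bullet> x) {x. normW (B *v x) \<le> 1} M \<and>
           (\<forall>\<alpha>. dual_norm normV \<alpha> \<le> 1 \<longrightarrow>
              has_min (dual_norm normW) {\<beta>. transpose B *v \<beta> = transpose A *v \<alpha> + c} (\<mu> \<alpha>)) \<and>
           has_max \<mu> {\<alpha>. dual_norm normV \<alpha> \<le> 1} M"
proof -
  have "continuous_on UNIV (\<lambda>x. normV (A *v x) + c \<bullet> x)"
    by (intro continuous_intros continuous_on_compose2[OF is_norm_continuous_on[OF V, of UNIV]]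
        linear_continuous_on matrix_vector_mul_bounded_linear) auto
  then obtain M where M: "has_max (\<lambda>x. normV (A *v x) + c \<bullet> x) {x. normW (B *v x) \<le> 1} M"
    using attains_max_on_unit_ball[OF is_norm_compose_inj[OF inj W]] by blast
  have "\<exists>m. has_max (\<lambda>x. (transpose A *v \<alpha> + c) \<bullet> x) {x. normW (B *v x) \<le> 1} m \<and>
      has_min (dual_norm normW) {\<beta>. transpose B *v \<beta> = transpose A *v \<alpha> + c} m" for \<alpha>
    using min_dual_norm_eq_max_linear[OF inj W] by blast
  then obtain \<mu> where
    \<mu>max: "\<And>\<alpha>. has_max (\<lambda>x. (transpose A *v \<alpha> + c) \<bullet> x) {x. normW (B *v x) \<le> 1} (\<mu> \<alpha>)" and
    \<mu>min: "\<And>\<alpha>. has_min (dual_norm normW) {\<beta>. transpose B *v \<beta> = transpose A *v \<alpha> + c} (\<mu> \<alpha>)"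
    by metis
  have pairing: "(transpose A *v \<alpha> + c) \<bullet> x = (A *v x) \<bullet> \<alpha> + c \<bullet> x" for \<alpha> x
    by (simp only: inner_add_left inner_transpose_mult inner_commute[of \<alpha> "A *v x"])
  have le: "\<mu> \<alpha> \<le> M" if \<alpha>: "dual_norm normV \<alpha> \<le> 1" for \<alpha>
  proof -
    obtain x where x: "normW (B *v x) \<le> 1" "(transpose A *v \<alpha> + c) \<bullet> x = \<mu> \<alpha>"
      using \<mu>max unfolding has_max_def by blast
    have "(A *v x) \<bullet> \<alpha> \<le> dual_norm normV \<alpha> * normV (A *v x)"
      by (rule inner_le_norm_dual_norm[OF V])
    also have "\<dots> \<le> normV (A *v x)"
      using mult_right_mono[OF \<alpha> is_norm_nonneg[OF V]] by simp
    finally have "\<mu> \<alpha> \<le> normV (A *v x) + c \<bullet> x" using x(2) pairing by simp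
    also have "\<dots> \<le> M" using M x(1) unfolding has_max_def by blast
    finally show ?thesis .
  qed
  obtain x where x: "normW (B *v x) \<le> 1" "normV (A *v x) + c \<bullet> x = M"
    using M unfolding has_max_def by blast
  obtain \<alpha> where \<alpha>: "dual_norm normV \<alpha> \<le> 1" "\<alpha> \<bullet> (A *v x) = normV (A *v x)"
    using norming_functional[OF V] by blast
  have "(transpose A *v \<alpha> + c) \<bullet> x = M"
    using pairing \<alpha>(2) x(2) by (simp add: inner_commute)
  then have "M \<le> \<mu> \<alpha>"
    using \<mu>max[of \<alpha>] x(1) unfolding has_max_def by blast
  then have "has_max \<mu> {\<alpha>. dual_norm normV \<alpha> \<le> 1} M"
    unfolding has_max_def using le \<alpha>(1) by (auto intro: antisym)
  then show ?thesis using M \<mu>min by blast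
qed

theorem corollary3p2:
  fixes A :: "real ^ 'n ^ 'm"
    and B :: "real ^ 'n ^ 'l"
    and normV :: "real ^ 'm \<Rightarrow> real"
    and normW :: "real ^ 'l \<Rightarrow> real"
    and c :: "real ^ 'n"
  assumes "inj (\<lambda>x. B *v x)"
    and "is_norm normV"
    and "is_norm normW"
  shows "(\<exists>M \<mu>.
           has_max (\<lambda>x. normV (A *v x) + c \<bullet> x) {x. normW (B *v x) \<le> 1} M \<and>
           (\<forall>\<alpha>. dual_norm normV \<alpha> \<le> 1 \<longrightarrow>
              has_min (dual_norm normW) {\<beta>. transpose B *v \<beta> = transpose A *v \<alpha> + c} (\<mu> \<alpha>)) \<and>
           has_max \<mu> {\<alpha>. dual_norm normV \<alpha> \<le> 1} M) \<and>
         (\<exists>M \<mu>.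
           has_max (\<lambda>x. normV (A *v x)) {x. normW (B *v x) \<le> 1} M \<and>
           (\<forall>\<alpha>. dual_norm normV \<alpha> \<le> 1 \<longrightarrow>
              has_min (dual_norm normW) {\<beta>. transpose B *v \<beta> = transpose A *v \<alpha>} (\<mu> \<alpha>)) \<and>
           has_max \<mu> {\<alpha>. dual_norm normV \<alpha> \<le> 1} M)"
  using max_norm_eq_max_min_dual_norm[OF assms, of A c]
    max_norm_eq_max_min_dual_norm[OF assms, of A 0] by simp

end
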